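(* Let $1<p<\infty$, let $U\subset\mathbb R^N$ be open, let $w\in C^2(U)$, and let $x\in U$ with $\nabla w(x)\neq0$. With the notation of the context, with respect to the orthogonal decomposition $\mathbb R^N=T_x\Sigma_x\oplus\operatorname{span}\{\nu\}$ one has, at $x$, \[ D^2w=\begin{pmatrix}s\,\mathrm{II}&\nabla_\Sigma s\\(\nabla_\Sigma s)^T&\partial_\nu s\end{pmatrix}. \] Moreover, if \[ M_p[w]:=\frac12\bigl(DA+(DA)^T\bigr), \] where $DA$ denotes the Jacobian matrix of $A=|\nabla w|^{p-2}\nabla w$, then, at $x$, \[ M_p[w]=s^{p-2}\begin{pmatrix}s\,\mathrm{II}&\dfrac p2\nabla_\Sigma s\\[2mm]\dfrac p2(\nabla_\Sigma s)^T&(p-1)\partial_\nu s\end{pmatrix}. \]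
   Context: For $w\in C^2(U)$ set \[ s:=|\nabla w|,\qquad A:=|\nabla w|^{p-2}\nabla w,\qquad \mathcal R_w:=\{x\in U:\nabla w(x)\neq0\}. \] For $x\in\mathcal R_w$ let $\nu:=\nabla w/s$ (defined near $x$) and $\Sigma_x:=\{y\in U:w(y)=w(x)\}$, which is a $C^2$ hypersurface near $x$. $T_x\Sigma_x$ is its tangent space at $x$, and its second fundamental form is \[ \mathrm{II}(\tau,\eta):=\langle D_\tau\nu,\eta\rangle,\qquad \tau,\eta\in T_x\Sigma_x, \] viewed as a symmetric bilinear form on $T_x\Sigma_x$. The vector $\nabla_\Sigma s\in T_x\Sigma_x$ is the tangential gradient of $s$ and $\partial_\nu s:=\langle\nabla s,\nu\rangle$, so that $\nabla s=\nabla_\Sigma s+(\partial_\nu s)\nu$. Block matrices represent symmetric bilinear forms with respect to $T_x\Sigma_x\oplus\operatorname{span}\{\nu\}$, the upper-left block being the restriction to $T_x\Sigma_x$. *)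

theory Defs
  imports "HOL-Analysis.Analysis"
begin

definition grad :: "(real^'n \<Rightarrow> real) \<Rightarrow> real^'n \<Rightarrow> real^'n"
  where "grad f x = (THE D. GDERIV f x :> D)"

definition hessian :: "(real^'n \<Rightarrow> real) \<Rightarrow> real^'n \<Rightarrow> real^'n^'n"
  where "hessian f x = jacobian (grad f) (at x)"

(* Intended for open U: the derivatives are taken with respect to the full
   neighbourhood filter of each point. *)
definition C2_on :: "(real^'n) set \<Rightarrow> (real^'n \<Rightarrow> real) \<Rightarrow> bool"
  where "C2_on U f \<longleftrightarrow>
    (\<forall>y\<in>U. f differentiable (at y) \<and> grad f differentiable (at y)) \<and>
    continuous_on U (hessian f)"

definition grad_norm :: "(real^'n \<Rightarrow> real) \<Rightarrow> real^'n \<Rightarrow> real"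
  where "grad_norm w x = norm (grad w x)"

definition p_flux :: "real \<Rightarrow> (real^'n \<Rightarrow> real) \<Rightarrow> real^'n \<Rightarrow> real^'n"
  where "p_flux p w x = norm (grad w x) powr (p - 2) *\<^sub>R grad w x"

definition unit_normal :: "(real^'n \<Rightarrow> real) \<Rightarrow> real^'n \<Rightarrow> real^'n"
  where "unit_normal w x = grad w x /\<^sub>R grad_norm w x"

definition level_set :: "(real^'n) set \<Rightarrow> (real^'n \<Rightarrow> real) \<Rightarrow> real^'n \<Rightarrow> (real^'n) set"
  where "level_set U w x = {y \<in> U. w y = w x}"

(* Velocities at x of C^1 curves lying in S; for a C^1 submanifold S this is
   its tangent space at x. *)
definition tangent_space :: "(real^'n) set \<Rightarrow> real^'n \<Rightarrow> (real^'n) set"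
  where "tangent_space S x =
    {v. \<exists>\<gamma> e. e > 0 \<and> \<gamma> C1_differentiable_on {-e<..<e} \<and> \<gamma> ` {-e<..<e} \<subseteq> S \<and>
          \<gamma> 0 = x \<and> (\<gamma> has_vector_derivative v) (at 0)}"

(* Meaningful for tangent vectors t, h; the differentiated normal is the field
   on a neighbourhood of x in the ambient space. *)
definition second_ff :: "(real^'n \<Rightarrow> real) \<Rightarrow> real^'n \<Rightarrow> real^'n \<Rightarrow> real^'n \<Rightarrow> real"
  where "second_ff w x t h = frechet_derivative (unit_normal w) (at x) t \<bullet> h"

(* The vector of T representing the restriction to T of the differential of f,
   i.e. the T-component of grad f x. *)
definition tangential_grad ::
  "(real^'n) set \<Rightarrow> (real^'n \<Rightarrow> real) \<Rightarrow> real^'n \<Rightarrow> real^'n"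
  where "tangential_grad T f x =
    (THE g. g \<in> T \<and> (\<forall>t\<in>T. g \<bullet> t = frechet_derivative f (at x) t))"

definition normal_deriv ::
  "(real^'n \<Rightarrow> real) \<Rightarrow> (real^'n \<Rightarrow> real) \<Rightarrow> real^'n \<Rightarrow> real"
  where "normal_deriv w f x = grad f x \<bullet> unit_normal w x"

definition flux_sym_jacobian :: "real \<Rightarrow> (real^'n \<Rightarrow> real) \<Rightarrow> real^'n \<Rightarrow> real^'n^'n"
  where "flux_sym_jacobian p w x =
    (1/2) *\<^sub>R (jacobian (p_flux p w) (at x) + transpose (jacobian (p_flux p w) (at x)))"

(* The symmetric matrix M, read as the bilinear form (u, v) \<mapsto> u \<bullet> (M *v v), has the
   block form with rows (B, b) and (b^T, c) with respect to T \<oplus> span {n}: B is the form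
   on T, b \<in> T the off-diagonal column, and c the scalar entry in the basis n of span {n}. *)
definition has_block_form ::
  "real^'n^'n \<Rightarrow> (real^'n) set \<Rightarrow> real^'n \<Rightarrow>
   (real^'n \<Rightarrow> real^'n \<Rightarrow> real) \<Rightarrow> real^'n \<Rightarrow> real \<Rightarrow> bool"
  where "has_block_form M T n B b c \<longleftrightarrow>
    transpose M = M \<and> b \<in> T \<and>
    (\<forall>t\<in>T. \<forall>h\<in>T. \<forall>\<alpha> \<beta>.
       (t + \<alpha> *\<^sub>R n) \<bullet> (M *v (h + \<beta> *\<^sub>R n)) =
       B t h + \<beta> * (b \<bullet> t) + \<alpha> * (b \<bullet> h) + \<alpha> * \<beta> * c)"

definition orthogonal_decomposition :: "(real^'n) set \<Rightarrow> (real^'n) set \<Rightarrow> bool"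
  where "orthogonal_decomposition S T \<longleftrightarrow>
    subspace S \<and> subspace T \<and> (\<forall>s\<in>S. \<forall>t\<in>T. orthogonal s t) \<and>
    (\<forall>v. \<exists>s\<in>S. \<exists>t\<in>T. v = s + t)"

end

theory Submission
  imports Defs
begin

text \<open>Write \<nu> for the unit normal, s for |grad w| and H for the Hessian. Everything
  follows from differentiating grad w = s \<nu>. Since H is symmetric, the chain rule for the norm
  gives grad s = H \<nu>, whose tangential and normal parts form the last column of H. The quotient
  rule gives s D\<nu>(h) = H h - <grad s, h> \<nu>; paired with a tangent vector the last term
  disappears, which leaves s II = H on the tangent space. The product rule gives DA(h) = s^(p-2) (H
  h + (p-2) <grad s, h> \<nu>). Inside the bracket, symmetrising the rank-one term leaves the
  tangential block alone, adds (p-2)/2 times the tangential gradient off the diagonal, whence p/2,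
  and adds p-2 times the normal derivative in the corner, whence p-1.

  Two facts carry the analysis. \<open>derivative_of_gradient_self_adjoint\<close> obtains the
  symmetry of H from second differences, and \<open>tangent_space_level_set\<close> uses the inverse
  function theorem to identify the velocities of curves in the level set with the orthogonal
  complement of grad w.\<close>

section \<open>Gradients as representing vectors\<close>

lemma GDERIV_unique:
  assumes "GDERIV f x :> D" "GDERIV f x :> E"
  shows "D = E"
proof -
  have "(\<lambda>h. h \<bullet> D) = (\<lambda>h. h \<bullet> E)"
    using assms has_derivative_unique unfolding gderiv_def by blast
  then show ?thesis
    by (metis vector_eq_ldot)
qed

lemma grad_eqI: "GDERIV f x :> D \<Longrightarrow> grad f x = D"
  unfolding grad_def using GDERIV_unique by blast

lemma GDERIV_grad:
  fixes f :: "real^'n \<Rightarrow> real"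
  assumes "f differentiable (at x)"
  shows "GDERIV f x :> grad f x"
proof -
  obtain f' where f': "(f has_derivative f') (at x)"
    using assms differentiable_def by blast
  \<comment> \<open>The vector representing a linear functional is the value of its adjoint at
    1.\<close>
  then have "f' = (\<lambda>h. h \<bullet> adjoint f' 1)"
    using adjoint_works[OF has_derivative_linear[OF f'], of _ 1] by auto
  then have "GDERIV f x :> adjoint f' 1"
    unfolding gderiv_def using f' by metis
  then show ?thesis
    using grad_eqI by metis
qed

section \<open>Symmetry of the second derivative\<close>

text \<open>The second difference is the increment over [0, t] of \<theta> \<mapsto> f (x + \<theta>
  u + t v) - f (x + \<theta> u). The mean value theorem turns it into t times a difference of two
  values of \<open>g\<close> along u, and the linearisation of \<open>g\<close> at x evaluates that
  difference as t H v + o(t).\<close>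

lemma second_difference_quotient_tendsto:
  fixes f :: "'a::real_inner \<Rightarrow> real"
  assumes f: "eventually (\<lambda>y. GDERIV f y :> g y) (nhds x)"
    and g: "(g has_derivative H) (at x)"
  shows "((\<lambda>t. (f (x + t *\<^sub>R u + t *\<^sub>R v) - f (x + t *\<^sub>R u) - f (x + t *\<^sub>R v) + f x) / t\<^sup>2)
           \<longlongrightarrow> u \<bullet> H v) (at_right 0)"
proof (rule tendstoI)
  fix e :: real assume "e > 0"
  \<comment> \<open>All points used lie within t K of x; the summand 1 keeps K positive when u and v
    vanish.\<close>
  define K where "K = norm u + norm v + 1"
  have K: "K > 0" "norm u < K" "norm u + norm v < K" by (auto simp: K_def add_nonneg_pos)
  \<comment> \<open>With this value the remainder bound K * (2 * c * t * K) becomes (2/3) * e * t,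
    strictly below e * t.\<close>
  define c where "c = e / (3 * K\<^sup>2)"
  have c: "c > 0" using \<open>e > 0\<close> K by (simp add: c_def)
  interpret H: bounded_linear H using g has_derivative_bounded_linear by blast
  obtain d1 where d1: "d1 > 0" "\<And>y. dist y x < d1 \<Longrightarrow> GDERIV f y :> g y"
    using f unfolding eventually_nhds_metric by blast
  obtain d2 where d2: "d2 > 0"
    "\<And>y. norm (y - x) < d2 \<Longrightarrow> norm (g y - g x - H (y - x)) \<le> c * norm (y - x)"
    using g c unfolding has_derivative_at_alt by blast
  define d where "d = min d1 d2 / K"
  have d: "d > 0" using d1 d2 K by (simp add: d_def)
  have "dist ((f (x + t *\<^sub>R u + t *\<^sub>R v) - f (x + t *\<^sub>R u) - f (x + t *\<^sub>R v) + f x) / t\<^sup>2) (u \<bullet> H v) < e"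
    if t: "0 < t" "t < d" for t
  proof -
    have tK: "t * K < d1" "t * K < d2" using t K by (auto simp: d_def field_simps)
    have bound: "norm (\<theta> *\<^sub>R u) \<le> t * K" "norm (\<theta> *\<^sub>R u + t *\<^sub>R v) \<le> t * K"
      if "0 \<le> \<theta>" "\<theta> \<le> t" for \<theta>
    proof -
      have "norm (\<theta> *\<^sub>R u) \<le> t * norm u" using that by (simp add: mult_right_mono)
      moreover have "norm (\<theta> *\<^sub>R u + t *\<^sub>R v) \<le> norm (\<theta> *\<^sub>R u) + t * norm v"
        using norm_triangle_ineq[of "\<theta> *\<^sub>R u" "t *\<^sub>R v"] t by simp
      moreover have "t * norm u \<le> t * K" "t * (norm u + norm v) \<le> t * K"
        using t K by (auto intro!: mult_left_mono)
      ultimately show "norm (\<theta> *\<^sub>R u) \<le> t * K" "norm (\<theta> *\<^sub>R u + t *\<^sub>R v) \<le> t * K"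
        by (auto simp: algebra_simps)
    qed
    define \<phi> where "\<phi> = (\<lambda>\<theta>. f (x + (\<theta> *\<^sub>R u + t *\<^sub>R v)) - f (x + \<theta> *\<^sub>R u))"
    have f_line: "((\<lambda>\<theta>. f (x + (\<theta> *\<^sub>R u + z))) has_real_derivative u \<bullet> g (x + (\<theta> *\<^sub>R u + z))) (at \<theta>)"
      if "norm (\<theta> *\<^sub>R u + z) < d1" for \<theta> z
    proof -
      have "FDERIV f (x + (\<theta> *\<^sub>R u + z)) :> (\<lambda>h. h \<bullet> g (x + (\<theta> *\<^sub>R u + z)))"
        using d1(2)[of "x + (\<theta> *\<^sub>R u + z)"] that by (simp add: gderiv_def dist_norm)
      moreover have "((\<lambda>\<theta>. x + (\<theta> *\<^sub>R u + z)) has_derivative (\<lambda>h. h *\<^sub>R u)) (at \<theta>)"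
        by (auto intro!: derivative_eq_intros)
      ultimately have "((\<lambda>\<theta>. f (x + (\<theta> *\<^sub>R u + z))) has_derivative
          (\<lambda>h. (h *\<^sub>R u) \<bullet> g (x + (\<theta> *\<^sub>R u + z)))) (at \<theta>)"
        using has_derivative_compose by blast
      then show ?thesis by (simp add: has_field_derivative_def mult.commute[of _ "u \<bullet> _"])
    qed
    have der\<phi>: "(\<phi> has_real_derivative
        u \<bullet> g (x + (\<theta> *\<^sub>R u + t *\<^sub>R v)) - u \<bullet> g (x + \<theta> *\<^sub>R u)) (at \<theta>)"
      if "0 \<le> \<theta>" "\<theta> \<le> t" for \<theta>
      unfolding \<phi>_def using f_line[of \<theta> "t *\<^sub>R v"] f_line[of \<theta> 0] bound[OF that] tK
      by (auto intro!: derivative_intros)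
    obtain \<theta> where \<theta>: "0 < \<theta>" "\<theta> < t"
      "\<phi> t - \<phi> 0 = (t - 0) * (u \<bullet> g (x + (\<theta> *\<^sub>R u + t *\<^sub>R v)) - u \<bullet> g (x + \<theta> *\<^sub>R u))"
      using MVT2[OF t(1) der\<phi>] by blast
    define r where "r = (\<lambda>k. g (x + k) - g x - H k)"
    have r: "norm (r k) \<le> c * (t * K)" if "norm k \<le> t * K" for k
    proof -
      have "norm (r k) \<le> c * norm k"
        using d2(2)[of "x + k"] that tK by (simp add: r_def)
      also have "\<dots> \<le> c * (t * K)" using that c by simp
      finally show ?thesis .
    qed
    \<comment> \<open>The contributions of \<theta> u to the linear part cancel, so the unknown mean
      value point enters only through the remainders.\<close>
    have diff: "g (x + (\<theta> *\<^sub>R u + t *\<^sub>R v)) - g (x + \<theta> *\<^sub>R u)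
        = t *\<^sub>R H v + (r (\<theta> *\<^sub>R u + t *\<^sub>R v) - r (\<theta> *\<^sub>R u))"
      by (simp add: r_def H.add H.scaleR)
    have eq: "\<phi> t - \<phi> 0 = t\<^sup>2 * (u \<bullet> H v) + t * (u \<bullet> (r (\<theta> *\<^sub>R u + t *\<^sub>R v) - r (\<theta> *\<^sub>R u)))"
      unfolding \<theta>(3) inner_diff_right[symmetric] diff
      by (simp add: inner_add_right power2_eq_square algebra_simps)
    have "\<bar>u \<bullet> (r (\<theta> *\<^sub>R u + t *\<^sub>R v) - r (\<theta> *\<^sub>R u))\<bar>
        \<le> norm u * norm (r (\<theta> *\<^sub>R u + t *\<^sub>R v) - r (\<theta> *\<^sub>R u))"
      by (rule Cauchy_Schwarz_ineq2)
    also have "\<dots> \<le> K * (c * (t * K) + c * (t * K))"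
      using K r[OF bound(1)[of \<theta>]] r[OF bound(2)[of \<theta>]] \<theta>
      by (intro mult_mono order_trans[OF norm_triangle_ineq4] add_mono) auto
    also have "\<dots> = (2/3) * e * t"
      using K by (simp add: c_def power2_eq_square field_simps)
    also have "\<dots> < e * t" using \<open>e > 0\<close> t by simp
    finally have "\<bar>u \<bullet> (r (\<theta> *\<^sub>R u + t *\<^sub>R v) - r (\<theta> *\<^sub>R u))\<bar> / t < e"
      using t by (simp add: field_simps)
    moreover have "(\<phi> t - \<phi> 0) / t\<^sup>2 - u \<bullet> H v
        = (u \<bullet> (r (\<theta> *\<^sub>R u + t *\<^sub>R v) - r (\<theta> *\<^sub>R u))) / t"
      using t unfolding eq by (simp add: power2_eq_square field_simps)
    moreover have "\<phi> t - \<phi> 0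
        = f (x + t *\<^sub>R u + t *\<^sub>R v) - f (x + t *\<^sub>R u) - f (x + t *\<^sub>R v) + f x"
      by (simp add: \<phi>_def add.assoc)
    ultimately show ?thesis using t by (simp add: dist_real_def)
  qed
  then show "eventually (\<lambda>t. dist ((f (x + t *\<^sub>R u + t *\<^sub>R v) - f (x + t *\<^sub>R u)
      - f (x + t *\<^sub>R v) + f x) / t\<^sup>2) (u \<bullet> H v) < e) (at_right 0)"
    using d unfolding eventually_at_right_field by auto
qed

text \<open>The second difference is symmetric in u and v, so its quotient has both pairings as
  limit.\<close>

lemma derivative_of_gradient_self_adjoint:
  fixes f :: "'a::real_inner \<Rightarrow> real"
  assumes "eventually (\<lambda>y. GDERIV f y :> g y) (nhds x)"
    and "(g has_derivative H) (at x)"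
  shows "u \<bullet> H v = H u \<bullet> v"
proof -
  have "((\<lambda>t. (f (x + t *\<^sub>R u + t *\<^sub>R v) - f (x + t *\<^sub>R u) - f (x + t *\<^sub>R v) + f x) / t\<^sup>2)
      \<longlongrightarrow> v \<bullet> H u) (at_right 0)"
    using second_difference_quotient_tendsto[OF assms, of v u] by (simp add: algebra_simps)
  then have "u \<bullet> H v = v \<bullet> H u"
    by (rule tendsto_unique[OF trivial_limit_at_right_real second_difference_quotient_tendsto[OF assms]])
  then show ?thesis by (simp add: inner_commute)
qed

section \<open>The tangent space of a level set\<close>

text \<open>The curve with velocity \<open>v\<close> is \<open>t \<mapsto> F\<^sup>-\<^sup>1 (x + t v)\<close>, where \<open>F\<close> replaces the
  component of \<open>y - x\<close> along \<open>g x\<close> by \<open>w y - w x\<close>. The derivative of \<open>F\<close> is a rank-one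
  perturbation of the identity, so its inverse is explicit.\<close>
lemma tangent_space_level_set:
  fixes w :: "real^'n \<Rightarrow> real"
  assumes U: "open U" "x \<in> U"
    and w: "\<And>y. y \<in> U \<Longrightarrow> GDERIV w y :> g y"
    and g: "continuous_on U g" "g x \<noteq> 0"
  shows "tangent_space (level_set U w x) x = {v. v \<bullet> g x = 0}"
proof (intro set_eqI iffI)
  fix v assume "v \<in> tangent_space (level_set U w x) x"
  then obtain \<gamma> e where \<gamma>: "e > 0" "\<gamma> ` {-e<..<e} \<subseteq> level_set U w x" "\<gamma> 0 = x"
    "(\<gamma> has_vector_derivative v) (at 0)"
    unfolding tangent_space_def by blast
  have "FDERIV w (\<gamma> 0) :> (\<lambda>h. h \<bullet> g x)"
    using w[OF U(2)] \<gamma>(3) by (simp add: gderiv_def)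
  then have "((\<lambda>t. w (\<gamma> t)) has_derivative (\<lambda>h. (h *\<^sub>R v) \<bullet> g x)) (at 0)"
    using \<gamma>(4) has_derivative_compose unfolding has_vector_derivative_def by blast
  \<comment> \<open>Along a curve in the level set w is constant near 0.\<close>
  moreover have "((\<lambda>t. w (\<gamma> t)) has_derivative (\<lambda>h. 0)) (at 0)"
  proof (rule has_derivative_transform_within_open[of "\<lambda>_. w x"])
    show "w x = w (\<gamma> t)" if "t \<in> {-e<..<e}" for t
    proof -
      have "\<gamma> t \<in> level_set U w x" using \<gamma>(2) that by blast
      then show ?thesis by (simp add: level_set_def)
    qed
  qed (use \<gamma>(1) in auto)
  ultimately have "(\<lambda>h. (h *\<^sub>R v) \<bullet> g x) = (\<lambda>h. 0)"
    by (rule has_derivative_unique)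
  from fun_cong[OF this, of 1] show "v \<in> {v. v \<bullet> g x = 0}" by simp
next
  fix v assume "v \<in> {v. v \<bullet> g x = 0}"
  then have v: "g x \<bullet> v = 0" by (simp add: inner_commute)
  define n where "n = sgn (g x)"
  have n: "n \<bullet> n = 1" "n \<bullet> v = 0" "g x \<bullet> n = norm (g x)"
    using g(2) v by (auto simp: n_def sgn_div_norm power2_norm_eq_inner[symmetric] power2_eq_square)
  define F where "F = (\<lambda>y. y + (w y - w x - n \<bullet> (y - x)) *\<^sub>R n)"
  \<comment> \<open>The derivative is built in the normed space of bounded linear maps, since the
    inverse function theorem asks for its continuity there.\<close>
  define F' where "F' = (\<lambda>y. id_blinfun + (blinfun_scaleR_left n o\<^sub>L blinfun_inner_left (g y - n)))"
  have F': "F' y h = h + ((g y - n) \<bullet> h) *\<^sub>R n" for y h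
    by (simp add: F'_def blinfun.bilinear_simps inner_commute)
  \<comment> \<open>This is the Sherman-Morrison inverse of I + n a^T with a = g x - n; its
    denominator 1 + a . n equals the norm of g x.\<close>
  define G where "G = id_blinfun -
    (blinfun_scaleR_left n o\<^sub>L blinfun_inner_left ((1 / norm (g x)) *\<^sub>R (g x - n)))"
  have G: "G h = h - (((g x - n) \<bullet> h) / norm (g x)) *\<^sub>R n" for h
    by (simp add: G_def blinfun.bilinear_simps inner_commute)
  have derF: "(F has_derivative F' y) (at y)" if "y \<in> U" for y
  proof -
    have "(w has_derivative (\<lambda>h. h \<bullet> g y)) (at y)"
      using w[OF that] by (simp add: gderiv_def)
    then have "(F has_derivative (\<lambda>h. h + (h \<bullet> g y - n \<bullet> h) *\<^sub>R n)) (at y)"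
      unfolding F_def by (auto intro!: derivative_eq_intros)
    then show ?thesis
      by (rule has_derivative_eq_rhs) (simp add: fun_eq_iff F' inner_diff_left inner_diff_right inner_commute)
  qed
  have contF: "continuous_on U F'"
    unfolding F'_def using g(1)
    by (intro continuous_intros bounded_linear.continuous_on[OF bounded_linear_blinfun_inner_left])
  have inv: "G o\<^sub>L F' x = id_blinfun"
  proof (rule blinfun_eqI)
    fix i
    have "(g x - n) \<bullet> F' x i = ((g x - n) \<bullet> i) * norm (g x)"
      using n by (simp add: F' inner_add_right inner_diff_left algebra_simps)
    then show "(G o\<^sub>L F' x) i = id_blinfun i"
      using g(2) by (simp add: G) (simp add: F')
  qed
  obtain U' V k k' where k: "open U'" "U' \<subseteq> U" "x \<in> U'" "open V" "F x \<in> V"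
    "homeomorphism U' V F k"
    and derk: "\<And>y. y \<in> V \<Longrightarrow> (k has_derivative k' y) (at y)"
      "\<And>y. y \<in> V \<Longrightarrow> k' y = inv (F' (k y))" "\<And>y. y \<in> V \<Longrightarrow> bij (F' (k y))"
    using inverse_function_theorem[OF U(1) derF contF U(2) inv] by blast
  have Fx: "F x = x" by (simp add: F_def)
  \<comment> \<open>\<open>F' (k y)\<close> maps n to (g (k y) . n) n, so injectivity forbids a zero
    factor.\<close>
  have gn: "g (k y) \<bullet> n \<noteq> 0" if "y \<in> V" for y
  proof
    assume "g (k y) \<bullet> n = 0"
    then have "F' (k y) n = F' (k y) 0"
      using n(1) by (simp add: F' inner_diff_left)
    then have "n = 0" using derk(3)[OF that] bij_is_inj injD by metis
    then show False using n(1) by simp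
  qed
  \<comment> \<open>The preimage of v is v corrected along n until it is orthogonal to the gradient
    at \<open>k y\<close>.\<close>
  have k'v: "k' y v = v - ((g (k y) \<bullet> v) / (g (k y) \<bullet> n)) *\<^sub>R n" if "y \<in> V" for y
  proof -
    have "F' (k y) (v - ((g (k y) \<bullet> v) / (g (k y) \<bullet> n)) *\<^sub>R n) = v"
      using gn[OF that] n
      by (simp add: F' inner_diff_left inner_diff_right field_simps)
    then show ?thesis
      unfolding derk(2)[OF that] using derk(3)[OF that] by (metis bij_inv_eq_iff)
  qed
  have "open ((\<lambda>t::real. x + t *\<^sub>R v) -` V)"
    using k(4) by (intro open_vimage continuous_intros)
  moreover have "0 \<in> (\<lambda>t::real. x + t *\<^sub>R v) -` V" using k(5) Fx by simp
  ultimately obtain e where e: "e > 0" "\<And>t. \<bar>t\<bar> < e \<Longrightarrow> x + t *\<^sub>R v \<in> V"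
    unfolding open_dist by (auto simp: dist_real_def dest!: bspec[where x = 0])
  define \<gamma> where "\<gamma> = (\<lambda>t. k (x + t *\<^sub>R v))"
  have FkV: "F (k y) = y" "k y \<in> U" if "y \<in> V" for y
    using k(2,6) that by (auto simp: homeomorphism_def)
  have der\<gamma>: "(\<gamma> has_vector_derivative k' (x + t *\<^sub>R v) v) (at t)" if "\<bar>t\<bar> < e" for t
  proof -
    interpret k': bounded_linear "k' (x + t *\<^sub>R v)"
      using derk(1)[OF e(2)[OF that]] has_derivative_bounded_linear by blast
    have "((\<lambda>t. x + t *\<^sub>R v) has_derivative (\<lambda>h. h *\<^sub>R v)) (at t)"
      by (auto intro!: derivative_eq_intros)
    from has_derivative_compose[OF this derk(1)[OF e(2)[OF that]]] show ?thesis
      by (simp add: \<gamma>_def has_vector_derivative_def k'.scaleR)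
  qed
  have cont\<gamma>: "continuous_on {-e<..<e} \<gamma>"
    by (intro continuous_at_imp_continuous_on ballI has_vector_derivative_continuous[OF der\<gamma>])
      auto
  have "\<gamma> C1_differentiable_on {-e<..<e}"
    unfolding C1_differentiable_on_def
  proof (intro exI conjI ballI)
    \<comment> \<open>Expressing the velocity through g along the curve reduces its continuity to
      that of g and \<gamma>, with a nonvanishing denominator.\<close>
    show "(\<gamma> has_vector_derivative v - ((g (\<gamma> t) \<bullet> v) / (g (\<gamma> t) \<bullet> n)) *\<^sub>R n) (at t)"
      if "t \<in> {-e<..<e}" for t
      using der\<gamma>[of t] k'v[OF e(2)[of t]] that by (simp add: \<gamma>_def abs_less_iff)
    have "continuous_on {-e<..<e} (\<lambda>t. g (\<gamma> t))"
      using FkV e by (intro continuous_on_compose2[OF g(1) cont\<gamma>]) (auto simp: \<gamma>_def abs_less_iff)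
    then show "continuous_on {-e<..<e} (\<lambda>t. v - ((g (\<gamma> t) \<bullet> v) / (g (\<gamma> t) \<bullet> n)) *\<^sub>R n)"
      using gn e by (intro continuous_intros) (auto simp: \<gamma>_def abs_less_iff)
  qed
  moreover have "\<gamma> ` {-e<..<e} \<subseteq> level_set U w x"
  proof clarify
    fix t assume "t \<in> {-e<..<e}"
    then have t: "x + t *\<^sub>R v \<in> V" using e by auto
    \<comment> \<open>F stores the increment of w in the n-coordinate, and the line x + t v has no
      increment in that coordinate.\<close>
    have "n \<bullet> (F (\<gamma> t) - x) = w (\<gamma> t) - w x"
      using n by (simp add: F_def inner_add_right inner_diff_right)
    moreover have "F (\<gamma> t) - x = t *\<^sub>R v" using FkV(1)[OF t] by (simp add: \<gamma>_def)
    ultimately show "\<gamma> t \<in> level_set U w x"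
      using n(2) FkV(2)[OF t] by (simp add: level_set_def \<gamma>_def)
  qed
  moreover have \<gamma>0: "\<gamma> 0 = x"
    using k(3,6) Fx by (metis \<gamma>_def add.right_neutral homeomorphism_apply1 scaleR_zero_left)
  moreover have "(\<gamma> has_vector_derivative v) (at 0)"
    using der\<gamma>[of 0] k'v[OF e(2)[of 0]] e(1) v \<gamma>0 by (simp add: \<gamma>_def)
  ultimately show "v \<in> tangent_space (level_set U w x) x"
    unfolding tangent_space_def using e(1) by blast
qed

section \<open>Orthogonal complements and block forms\<close>

lemma orthogonal_decomposition_complement:
  "orthogonal_decomposition {v. v \<bullet> n = 0} (span {n})"
  unfolding orthogonal_decomposition_def
proof (intro conjI allI ballI)
  show "subspace {v. v \<bullet> n = 0}"
    by (auto simp: subspace_def inner_add_left)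
  show "orthogonal s t" if "s \<in> {v. v \<bullet> n = 0}" "t \<in> span {n}" for s t
    using that by (auto simp: span_singleton orthogonal_def)
  fix v
  \<comment> \<open>For n = 0 the quotient is 0, and the complement is the whole space.\<close>
  define a where "a = (v \<bullet> n) / (n \<bullet> n)"
  have "(v - a *\<^sub>R n) \<bullet> n = 0"
    by (cases "n = 0") (auto simp: a_def inner_diff_left)
  moreover have "a *\<^sub>R n \<in> span {n}" by (auto simp: span_singleton)
  moreover have "v = (v - a *\<^sub>R n) + a *\<^sub>R n" by simp
  ultimately show "\<exists>s\<in>{v. v \<bullet> n = 0}. \<exists>t\<in>span {n}. v = s + t" by blast
qed (rule subspace_span)

lemma inner_transpose_matrix_vector:
  fixes A :: "real^'n^'m"
  shows "u \<bullet> (transpose A *v v) = (A *v u) \<bullet> v"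
  by (simp add: transpose_matrix_vector inner_commute[of u] dot_lmul_matrix inner_commute[of v])

text \<open>Bilinearity reduces the block identity to pairings of the summands, and symmetry of M
  supplies the lower-left block from the upper-right one.\<close>

lemma has_block_formI:
  assumes sym: "transpose M = M" and b: "b \<in> T"
    and TT: "\<And>t h. t \<in> T \<Longrightarrow> h \<in> T \<Longrightarrow> t \<bullet> (M *v h) = B t h"
    and Tn: "\<And>t. t \<in> T \<Longrightarrow> t \<bullet> (M *v n) = b \<bullet> t"
    and nn: "n \<bullet> (M *v n) = c"
  shows "has_block_form M T n B b c"
proof -
  have nT: "n \<bullet> (M *v h) = b \<bullet> h" if "h \<in> T" for h
    using inner_transpose_matrix_vector[of n M h] Tn[OF that] sym by (simp add: inner_commute)
  show ?thesis
    unfolding has_block_form_def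
    using sym b by (auto simp: matrix_vector_right_distrib matrix_vector_mult_scaleR
        inner_add_left inner_add_right TT Tn nn nT algebra_simps)
qed

section \<open>Derivatives of the gradient norm, the unit normal and the flux\<close>

text \<open>Away from 0 the norm has gradient \<open>sgn\<close>, here the unit normal;
  self-adjointness of H moves H onto it. Hence the normal column of the Hessian is the gradient of
  s.\<close>

lemma GDERIV_grad_norm:
  assumes "(grad w has_derivative (\<lambda>h. H *v h)) (at x)" "grad w x \<noteq> 0" "transpose H = H"
  shows "GDERIV (grad_norm w) x :> H *v unit_normal w x"
proof -
  have "(norm has_derivative (\<lambda>h. h \<bullet> sgn (grad w x))) (at (grad w x))"
    using GDERIV_norm[OF assms(2)] by (simp add: gderiv_def)
  from has_derivative_compose[OF assms(1) this]
  have "((\<lambda>y. norm (grad w y)) has_derivative (\<lambda>h. (H *v h) \<bullet> unit_normal w x)) (at x)"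
    by (simp add: sgn_div_norm unit_normal_def grad_norm_def)
  moreover have "(H *v h) \<bullet> k = h \<bullet> (H *v k)" for h k
    using inner_transpose_matrix_vector[of h H k] assms(3) by simp
  ultimately show ?thesis
    by (simp add: gderiv_def grad_norm_def[abs_def])
qed

text \<open>Quotient rule, with grad w / s^2 rewritten as the unit normal divided by s.\<close>

lemma has_derivative_unit_normal:
  assumes "(grad w has_derivative (\<lambda>h. H *v h)) (at x)" "grad w x \<noteq> 0" "transpose H = H"
  shows "(unit_normal w has_derivative (\<lambda>h. (1 / grad_norm w x) *\<^sub>R
    (H *v h - (h \<bullet> (H *v unit_normal w x)) *\<^sub>R unit_normal w x))) (at x)"
proof -
  have "(grad_norm w has_derivative (\<lambda>h. h \<bullet> (H *v unit_normal w x))) (at x)"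
    using GDERIV_grad_norm[OF assms] by (simp add: gderiv_def)
  moreover have "grad_norm w x \<noteq> 0" using assms(2) by (simp add: grad_norm_def)
  ultimately have "((\<lambda>y. inverse (grad_norm w y) *\<^sub>R grad w y) has_derivative (\<lambda>h. (1 / grad_norm w x) *\<^sub>R
    (H *v h - (h \<bullet> (H *v unit_normal w x)) *\<^sub>R unit_normal w x))) (at x)"
    using assms(1)
    by (auto intro!: derivative_eq_intros simp: unit_normal_def[of w x] field_simps scaleR_diff_right)
  then show ?thesis by (simp add: unit_normal_def[abs_def])
qed

text \<open>Product rule for the scalar s^(p-2) and the field grad w; the scalar's derivative yields
  a rank-one term along the unit normal.\<close>

lemma has_derivative_p_flux:
  assumes "(grad w has_derivative (\<lambda>h. H *v h)) (at x)" "grad w x \<noteq> 0" "transpose H = H"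
  shows "(p_flux p w has_derivative (\<lambda>h. grad_norm w x powr (p - 2) *\<^sub>R
    (H *v h + ((p - 2) * (h \<bullet> (H *v unit_normal w x))) *\<^sub>R unit_normal w x))) (at x)"
proof -
  have d: "(grad_norm w has_derivative (\<lambda>h. h \<bullet> (H *v unit_normal w x))) (at x)"
    using GDERIV_grad_norm[OF assms] by (simp add: gderiv_def)
  have s: "grad_norm w x > 0" using assms(2) by (simp add: grad_norm_def)
  have pw: "((\<lambda>r. r powr (p - 2)) has_derivative (\<lambda>h. h * ((p - 2) * grad_norm w x powr (p - 3))))
      (at (grad_norm w x))"
    using has_real_derivative_powr[OF s, of "p - 2"]
    by (simp add: has_field_derivative_def diff_diff_eq mult.commute[of _ "_ * _"])
  have "((\<lambda>y. grad_norm w y powr (p - 2)) has_derivative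
      (\<lambda>h. (h \<bullet> (H *v unit_normal w x)) * ((p - 2) * grad_norm w x powr (p - 3)))) (at x)"
    by (rule has_derivative_compose[OF d pw])
  from has_derivative_scaleR[OF this assms(1)]
  have "((\<lambda>y. grad_norm w y powr (p - 2) *\<^sub>R grad w y) has_derivative
      (\<lambda>h. grad_norm w x powr (p - 2) *\<^sub>R (H *v h) +
        ((h \<bullet> (H *v unit_normal w x)) * ((p - 2) * grad_norm w x powr (p - 3))) *\<^sub>R grad w x)) (at x)"
    .
  \<comment> \<open>One factor s from grad w = s \<nu> raises the exponent p - 3 to p - 2.\<close>
  moreover have "(a * ((p - 2) * grad_norm w x powr (p - 3))) *\<^sub>R grad w x
      = grad_norm w x powr (p - 2) *\<^sub>R (((p - 2) * a) *\<^sub>R unit_normal w x)" for a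
  proof -
    have "grad w x = grad_norm w x *\<^sub>R unit_normal w x"
      using s by (simp add: unit_normal_def)
    then have "(a * ((p - 2) * grad_norm w x powr (p - 3))) *\<^sub>R grad w x
        = ((grad_norm w x powr (p - 3) * grad_norm w x) * ((p - 2) * a)) *\<^sub>R unit_normal w x"
      by (simp add: mult_ac)
    also have "grad_norm w x powr (p - 3) * grad_norm w x = grad_norm w x powr (p - 2)"
      using powr_add[of "grad_norm w x" "p - 3" 1] s by simp
    finally show ?thesis by simp
  qed
  ultimately have "((\<lambda>y. grad_norm w y powr (p - 2) *\<^sub>R grad w y) has_derivative
      (\<lambda>h. grad_norm w x powr (p - 2) *\<^sub>R
        (H *v h + ((p - 2) * (h \<bullet> (H *v unit_normal w x))) *\<^sub>R unit_normal w x))) (at x)"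
    by (simp only: scaleR_add_right)
  then show ?thesis by (simp add: p_flux_def[abs_def] grad_norm_def)
qed

text \<open>Removing the normal component of D does not change its pairings with vectors orthogonal
  to n, so the orthogonal projection of D is the representing vector.\<close>

lemma tangential_grad_complement:
  assumes f: "GDERIV f x :> D" and n: "n \<bullet> n = 1"
  shows "tangential_grad {v. v \<bullet> n = 0} f x = D - (D \<bullet> n) *\<^sub>R n"
proof -
  have f': "frechet_derivative f (at x) = (\<lambda>h. h \<bullet> D)"
    using f frechet_derivative_at unfolding gderiv_def by metis
  show ?thesis
    unfolding tangential_grad_def f'
  proof (rule the_equality)
    show "D - (D \<bullet> n) *\<^sub>R n \<in> {v. v \<bullet> n = 0} \<and>
        (\<forall>t\<in>{v. v \<bullet> n = 0}. (D - (D \<bullet> n) *\<^sub>R n) \<bullet> t = t \<bullet> D)"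
      using n by (auto simp: inner_diff_left) (simp add: inner_commute)
  next
    fix k assume k: "k \<in> {v. v \<bullet> n = 0} \<and> (\<forall>t\<in>{v. v \<bullet> n = 0}. k \<bullet> t = t \<bullet> D)"
    \<comment> \<open>The difference of two representing vectors lies in the subspace and is
      orthogonal to it, hence to itself.\<close>
    define z where "z = k - (D - (D \<bullet> n) *\<^sub>R n)"
    have "z \<bullet> n = 0" using k n by (simp add: z_def inner_diff_left)
    moreover from this have "(k - (D - (D \<bullet> n) *\<^sub>R n)) \<bullet> z = 0"
      using k by (simp add: inner_diff_left inner_commute[of D z] inner_commute[of n z])
    then have "z \<bullet> z = 0" by (simp only: z_def)
    ultimately show "k = D - (D \<bullet> n) *\<^sub>R n" by (simp add: z_def)
  qed
qed

section \<open>Reading off the blocks\<close>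

theorem proposition1p7:
  fixes p :: real and U :: "(real^'n) set" and w :: "real^'n \<Rightarrow> real" and x :: "real^'n"
  assumes "1 < p"
    and "open U"
    and "C2_on U w"
    and "x \<in> U"
    and "grad w x \<noteq> 0"
  shows
    "let s = grad_norm w;
         \<nu> = unit_normal w x;
         T = tangent_space (level_set U w x) x
     in orthogonal_decomposition T (span {\<nu>}) \<and>
        has_block_form (hessian w x) T \<nu>
          (\<lambda>\<tau> \<eta>. s x * second_ff w x \<tau> \<eta>)
          (tangential_grad T s x)
          (normal_deriv w s x) \<and>
        has_block_form (flux_sym_jacobian p w x) T \<nu>
          (\<lambda>\<tau> \<eta>. s x powr (p - 2) * (s x * second_ff w x \<tau> \<eta>))
          (s x powr (p - 2) *\<^sub>R ((p / 2) *\<^sub>R tangential_grad T s x))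
          (s x powr (p - 2) * ((p - 1) * normal_deriv w s x))"
proof -
  define H where "H = hessian w x"
  define n where "n = unit_normal w x"
  define s where "s = grad_norm w x"
  define J where "J = jacobian (p_flux p w) (at x)"
  define M where "M = flux_sym_jacobian p w x"
  define T where "T = tangent_space (level_set U w x) x"
  have w: "GDERIV w y :> grad w y" and dg: "grad w differentiable (at y)" if "y \<in> U" for y
    using assms(3) that GDERIV_grad by (auto simp: C2_on_def)
  have H: "(grad w has_derivative (\<lambda>h. H *v h)) (at x)"
    using dg[OF assms(4)] by (simp add: jacobian_works H_def hessian_def)
  have "eventually (\<lambda>y. GDERIV w y :> grad w y) (nhds x)"
    using assms(2,4) w eventually_nhds by blast
  note sym = derivative_of_gradient_self_adjoint[OF this H]
  have "transpose H *v v = H *v v" for v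
    using sym[of _ v] inner_transpose_matrix_vector[of _ H v] by (metis vector_eq_ldot)
  then have tH: "transpose H = H" by (simp add: matrix_eq)
  note deriv = H assms(5) tH
  have s: "s > 0" using assms(5) by (simp add: s_def grad_norm_def)
  have n: "n \<bullet> n = 1" and gn: "grad w x = s *\<^sub>R n"
    using s by (auto simp: n_def s_def unit_normal_def grad_norm_def power2_norm_eq_inner[symmetric]
        power2_eq_square)
  have T: "T = {v. v \<bullet> n = 0}"
  proof -
    have "continuous_on U (grad w)"
      using dg differentiable_imp_continuous_within by (blast intro: continuous_at_imp_continuous_on)
    from tangent_space_level_set[OF assms(2,4) w this assms(5)] show ?thesis
      using s by (simp add: T_def gn)
  qed
  have Ds: "GDERIV (grad_norm w) x :> H *v n"
    using GDERIV_grad_norm[OF deriv] by (simp add: n_def)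
  have nd: "normal_deriv w (grad_norm w) x = n \<bullet> (H *v n)"
    using grad_eqI[OF Ds] by (simp add: normal_deriv_def n_def inner_commute)
  have tg: "tangential_grad T (grad_norm w) x = H *v n - ((H *v n) \<bullet> n) *\<^sub>R n"
    unfolding T by (rule tangential_grad_complement[OF Ds n])
  have tgT: "tangential_grad T (grad_norm w) x \<in> T"
    unfolding tg using n by (simp add: T inner_diff_left)
  have tgt: "tangential_grad T (grad_norm w) x \<bullet> t = t \<bullet> (H *v n)" if "t \<in> T" for t
    using that unfolding tg by (simp add: T inner_diff_left inner_diff_right inner_commute)
  have "frechet_derivative (unit_normal w) (at x) =
      (\<lambda>h. (1 / s) *\<^sub>R (H *v h - (h \<bullet> (H *v n)) *\<^sub>R n))"
    unfolding s_def n_def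
    by (rule frechet_derivative_at[OF has_derivative_unit_normal[OF deriv], symmetric])
  then have "s * second_ff w x t h = (H *v t) \<bullet> h - (t \<bullet> (H *v n)) * (n \<bullet> h)" for t h
    using s by (simp add: second_ff_def inner_diff_left)
  \<comment> \<open>The term from differentiating 1/s points along n and is invisible to the tangent
    vector h.\<close>
  then have II: "s * second_ff w x t h = t \<bullet> (H *v h)" if "h \<in> T" for t h
    using that unfolding sym T by (simp add: inner_commute[of n h])
  note pf = has_derivative_p_flux[OF deriv, of p, folded n_def s_def]
  have J: "J *v h = s powr (p - 2) *\<^sub>R (H *v h + ((p - 2) * (h \<bullet> (H *v n))) *\<^sub>R n)" for h
  proof -
    have "(p_flux p w has_derivative (\<lambda>h. J *v h)) (at x)"
      using pf jacobian_works unfolding J_def differentiable_def by blast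
    from fun_cong[OF has_derivative_unique[OF this pf]] show ?thesis .
  qed
  have tM: "transpose M = M"
    by (simp add: M_def flux_sym_jacobian_def vec_eq_iff transpose_def)
  \<comment> \<open>All three blocks come from this one formula: two tangent vectors kill both
    correction terms, a mixed pair keeps one and gives 1 + (p-2)/2 = p/2, and the pair n, n keeps
    both and gives 1 + (p-2) = p-1.\<close>
  have M: "u \<bullet> (M *v v) = s powr (p - 2) * (u \<bullet> (H *v v) +
      (p - 2) / 2 * ((v \<bullet> (H *v n)) * (u \<bullet> n) + (u \<bullet> (H *v n)) * (v \<bullet> n)))" for u v
  proof -
    have "u \<bullet> (transpose J *v v) = (J *v u) \<bullet> v"
      by (rule inner_transpose_matrix_vector)
    then have "u \<bullet> (M *v v) = (u \<bullet> (J *v v) + (J *v u) \<bullet> v) / 2"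
      by (simp add: M_def flux_sym_jacobian_def J_def[symmetric] scaleR_matrix_vector_assoc[symmetric]
          matrix_vector_mult_add_rdistrib inner_add_right)
    then show ?thesis
      unfolding J using sym[of u v]
      by (simp add: inner_add_left inner_add_right inner_commute) (simp add: field_simps)
  qed
  have "has_block_form H T n (\<lambda>t h. s * second_ff w x t h)
      (tangential_grad T (grad_norm w) x) (normal_deriv w (grad_norm w) x)"
    by (rule has_block_formI[OF tH tgT]) (simp_all only: II tgt nd)
  moreover have "has_block_form M T n (\<lambda>t h. s powr (p - 2) * (s * second_ff w x t h))
      (s powr (p - 2) *\<^sub>R ((p / 2) *\<^sub>R tangential_grad T (grad_norm w) x))
      (s powr (p - 2) * ((p - 1) * normal_deriv w (grad_norm w) x))"
  proof (rule has_block_formI[OF tM])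
    show "s powr (p - 2) *\<^sub>R ((p / 2) *\<^sub>R tangential_grad T (grad_norm w) x) \<in> T"
      using tgT by (simp add: T)
    show "t \<bullet> (M *v h) = s powr (p - 2) * (s * second_ff w x t h)" if "t \<in> T" "h \<in> T" for t h
      using that II[OF that(2)] by (simp add: M T)
    show "t \<bullet> (M *v n) = (s powr (p - 2) *\<^sub>R ((p / 2) *\<^sub>R tangential_grad T (grad_norm w) x)) \<bullet> t"
      if "t \<in> T" for t
      using that tgt[OF that] n by (simp add: M T field_simps)
    show "n \<bullet> (M *v n) = s powr (p - 2) * ((p - 1) * normal_deriv w (grad_norm w) x)"
      using n by (simp add: M nd field_simps)
  qed
  moreover have "orthogonal_decomposition T (span {n})"
    unfolding T by (rule orthogonal_decomposition_complement)
  ultimately show ?thesis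
    unfolding Let_def H_def n_def s_def M_def T_def by (intro conjI)
qed

end
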